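(* Let $n$ be a positive integer. The largest value of $\varepsilon>0$ such that an equilateral $H$-triangle of side $n+\varepsilon$ can be covered by $n^2+2$ equilateral $H$-triangles of side $1$ is $\varepsilon=1/(n+1)$ (i.e., such a covering exists for $\varepsilon=1/(n+1)$ and does not exist for any $\varepsilon>1/(n+1)$).
   Context: An $H$-triangle is a triangle in the plane with one side parallel to the $x$-axis. "Cover" means the union of the covering triangles contains the given triangle. *)

theory Defs
  imports "HOL-Analysis.Analysis"
begin

definition H_triangle :: "real^2 \<Rightarrow> real^2 \<Rightarrow> real^2 \<Rightarrow> bool" where
  "H_triangle a b c \<longleftrightarrow>
     \<not> collinear {a, b, c} \<and> (a $ 2 = b $ 2 \<or> b $ 2 = c $ 2 \<or> c $ 2 = a $ 2)"

(* T is the closed solid triangle; both orientations (apex above or below the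
   horizontal side) are included. *)
definition equilateral_H_triangle :: "real \<Rightarrow> (real^2) set \<Rightarrow> bool" where
  "equilateral_H_triangle s T \<longleftrightarrow>
     (\<exists>a b c. H_triangle a b c \<and> dist a b = s \<and> dist b c = s \<and> dist c a = s \<and>
              T = convex hull {a, b, c})"

definition coverable_by_unit_H_triangles :: "nat \<Rightarrow> (real^2) set \<Rightarrow> bool" where
  "coverable_by_unit_H_triangles k T \<longleftrightarrow>
     (\<exists>C. finite C \<and> card C = k \<and> (\<forall>S\<in>C. equilateral_H_triangle 1 S) \<and> T \<subseteq> \<Union>C)"

lemma equilateral_H_triangle_exists:
  assumes "s > 0"
  shows "\<exists>T. equilateral_H_triangle s T"
proof -
  define b c :: "real^2" where "b = vector [s, 0]" and "c = vector [s / 2, s * sqrt 3 / 2]"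
  have bc: "b $ 1 = s" "b $ 2 = 0" "c $ 1 = s / 2" "c $ 2 = s * sqrt 3 / 2"
    by (simp_all add: b_def c_def)
  have "\<not> collinear {0, b, c}"
  proof
    assume "collinear {0, b, c}"
    then have "b = 0 \<or> c = 0 \<or> (\<exists>r. c = r *\<^sub>R b)"
      by (simp add: collinear_lemma)
    then have "b $ 1 = 0 \<or> c $ 2 = 0"
      using bc(2) by auto
    then show False
      using assms bc by simp
  qed
  moreover have sq: "(s / 2)\<^sup>2 + (s * sqrt 3 / 2)\<^sup>2 = s\<^sup>2"
    by (simp add: power_divide power_mult_distrib)
  have "dist 0 b = s"
    using assms by (simp add: dist_norm norm_vec_def L2_set_def sum_2 bc)
  moreover have "dist b c = s" "dist c 0 = s"
    using assms sq by (simp_all add: dist_norm norm_vec_def L2_set_def sum_2 bc)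
  ultimately have "equilateral_H_triangle s (convex hull {0, b, c})"
    unfolding equilateral_H_triangle_def H_triangle_def
    using bc(2) by (intro exI[of _ 0] exI[of _ b] exI[of _ c]) simp
  then show ?thesis by blast
qed

end

theory Submission
  imports Defs
begin

text \<open>
In skew coordinates equilateral H-triangles become right isosceles ones, and we may take the large
triangle to be \<open>x \<ge> 0\<close>, \<open>y \<ge> 0\<close>, \<open>x + y \<le> n + \<epsilon>\<close>.

Covering: for \<open>\<epsilon> = 1/(n+1)\<close> the bottom strip of height \<open>1 + \<epsilon>\<close> is covered by \<open>n + 1\<close> triangles standing
on the base and \<open>n\<close> triangles hanging from the top of the strip, with offset \<open>1 - \<epsilon>\<close>; above it
remains a triangle of side \<open>n - 1\<close>, which takes \<open>(n-1)\<^sup>2\<close> more.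

Optimality: for \<open>0 \<le> t \<le> 1\<close> let \<open>F t\<close> be the total length of the sections of the large triangle
at the heights \<open>t, t + 1, \<dots>, t + n\<close>, and let \<open>G t\<close> be the sum over the covering triangles of
\<open>1 - frac (\<plusminus>(t - b))\<close>, which bounds the total length of their sections. Then \<open>F \<le> G\<close>, the integral
of \<open>G - F\<close> is \<open>1 - n\<epsilon> - \<epsilon>\<^sup>2/2\<close>, and modulo 1 the function \<open>G - F\<close> equals \<open>c + m t + min t \<epsilon>\<close> for an
integer \<open>m\<close>, which is even because \<open>n\<^sup>2 + 2\<close> and \<open>n\<close> have the same parity. The integral of the
fractional part of such a function is at least \<open>min (3/8) (\<epsilon> - \<epsilon>\<^sup>2/2)\<close>, which is too much if
\<open>\<epsilon> > 1/(n+1)\<close>.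
\<close>

subsection \<open>Integrals of fractional parts\<close>

text \<open>\<open>x / 2 - saw x\<close> is a continuous antiderivative of \<open>frac\<close>.\<close>

definition saw :: "real \<Rightarrow> real" where
  "saw x = frac x * (1 - frac x) / 2"

lemma saw_nonneg: "0 \<le> saw x"
  unfolding saw_def using frac_lt_1[of x] frac_ge_0[of x] by simp

lemma saw_le: "saw x \<le> 1 / 8"
proof -
  have "0 \<le> (frac x - 1 / 2)\<^sup>2" by simp
  then show ?thesis unfolding saw_def by (simp add: power2_eq_square algebra_simps)
qed

lemma saw_add_int: "saw (x + of_int k) = saw x"
  by (simp add: saw_def frac_def)

text \<open>Exchanging \<open>frac x\<close> and \<open>1 - frac x\<close> does not change
  \<open>saw x\<close>, so one formula in the distance to \<open>k\<close> serves on both sides of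
  \<open>k\<close>. This gives continuity at the integers, where \<open>frac\<close> jumps.\<close>

lemma saw_near_int:
  assumes "\<bar>x - of_int k\<bar> < 1"
  shows "saw x = \<bar>x - of_int k\<bar> * (1 - \<bar>x - of_int k\<bar>) / 2"
proof (cases "of_int k \<le> x")
  case True
  then have "frac x = x - of_int k" using assms by (simp add: frac_unique_iff Ints_def)
  then show ?thesis using True by (simp add: saw_def)
next
  case False
  then have "frac x = x - of_int k + 1"
    using assms unfolding frac_unique_iff by (auto simp: algebra_simps)
  then show ?thesis using False by (simp add: saw_def)
qed

lemma continuous_saw: "isCont saw x"
proof -
  let ?k = "\<lfloor>x\<rfloor>"
  let ?h = "\<lambda>y. \<bar>y - of_int ?k\<bar> * (1 - \<bar>y - of_int ?k\<bar>) / 2"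
  have "x \<in> ball (of_int ?k) 1" by (simp add: dist_real_def abs_if) linarith
  then have "eventually (\<lambda>y. y \<in> ball (of_int ?k) 1) (nhds x)"
    by (intro eventually_nhds_in_open) auto
  then have "eventually (\<lambda>y. saw y = ?h y) (nhds x)"
    by eventually_elim (simp add: saw_near_int dist_real_def abs_minus_commute)
  moreover have "isCont ?h x" by (intro continuous_intros) simp
  ultimately show ?thesis by (subst isCont_cong)
qed

lemma has_derivative_saw:
  assumes "x \<notin> \<int>"
  shows "(saw has_real_derivative 1 / 2 - frac x) (at x)"
proof -
  let ?k = "\<lfloor>x\<rfloor>"
  let ?h = "\<lambda>y. (y - of_int ?k) * (1 - (y - of_int ?k)) / 2"
  have "frac x > 0" using assms by simp
  then have "x \<in> {of_int ?k<..<of_int ?k + 1}"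
    using frac_lt_1[of x] unfolding frac_def by simp
  then have "eventually (\<lambda>y. y \<in> {of_int ?k<..<of_int ?k + 1}) (nhds x)"
    by (intro eventually_nhds_in_open) auto
  then have ev: "eventually (\<lambda>y. saw y = ?h y) (nhds x)"
    by eventually_elim (simp add: saw_near_int[of _ ?k] abs_if)
  have "(?h has_real_derivative 1 / 2 - frac x) (at x)"
    by (auto intro!: derivative_eq_intros simp: frac_def field_simps)
  then show ?thesis using DERIV_cong_ev[OF refl ev refl] by simp
qed

text \<open>The fundamental theorem of calculus with an exceptional set: the antiderivative is
  continuous everywhere and has the right derivative except at the finitely many \<open>t\<close>
  where \<open>m * t + c\<close> is an integer.\<close>

lemma has_integral_frac_linear:
  fixes m :: real
  assumes "m \<noteq> 0" "a \<le> b"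
  shows "((\<lambda>t. frac (m * t + c)) has_integral
     (b - a) / 2 - (saw (m * b + c) - saw (m * a + c)) / m) {a..b}"
proof -
  let ?F = "\<lambda>t. t / 2 - saw (m * t + c) / m"
  define S where "S = {t \<in> {a..b}. m * t + c \<in> \<int>}"
  define M where "M = \<bar>m\<bar> * (\<bar>a\<bar> + \<bar>b\<bar>) + \<bar>c\<bar>"
  have "S \<subseteq> (\<lambda>z. (z - c) / m) ` {z \<in> \<int>. - M \<le> z \<and> z \<le> M}"
  proof
    fix t assume t: "t \<in> S"
    then have "\<bar>m * t\<bar> \<le> \<bar>m\<bar> * (\<bar>a\<bar> + \<bar>b\<bar>)"
      unfolding abs_mult S_def by (intro mult_left_mono) auto
    then have "\<bar>m * t + c\<bar> \<le> M" unfolding M_def by linarith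
    then show "t \<in> (\<lambda>z. (z - c) / m) ` {z \<in> \<int>. - M \<le> z \<and> z \<le> M}"
      using t assms(1) unfolding S_def by (intro image_eqI[of _ _ "m * t + c"]) auto
  qed
  then have "finite S" by (rule finite_subset) (intro finite_imageI finite_int_segment)
  have "((\<lambda>t. frac (m * t + c)) has_integral ?F b - ?F a) {a..b}"
  proof (rule fundamental_theorem_of_calculus_strong)
    show "finite S" by fact
    show "continuous_on {a..b} ?F"
      using assms(1)
      by (auto intro!: continuous_at_imp_continuous_on continuous_intros isCont_o2[OF _ continuous_saw])
    fix t assume "t \<in> {a..b} - S"
    then have "m * t + c \<notin> \<int>" unfolding S_def by simp
    from has_derivative_saw[OF this]
    have "((\<lambda>t. saw (m * t + c)) has_real_derivative (1 / 2 - frac (m * t + c)) * m) (at t)"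
      by (intro DERIV_chain2[where g = "\<lambda>t. m * t + c"]) (auto intro!: derivative_eq_intros)
    then have "(?F has_real_derivative 1 / 2 - (1 / 2 - frac (m * t + c)) * m / m) (at t)"
      by (intro DERIV_diff DERIV_cdivide DERIV_ident)
    then have "(?F has_real_derivative frac (m * t + c)) (at t)"
      using assms(1) by simp
    then show "(?F has_vector_derivative frac (m * t + c)) (at t)"
      by (simp add: has_real_derivative_iff_has_vector_derivative)
  qed (use assms in auto)
  moreover have "?F b - ?F a = (b - a) / 2 - (saw (m * b + c) - saw (m * a + c)) / m"
    by (simp add: diff_divide_distrib)
  ultimately show ?thesis by simp
qed

text \<open>The slope is \<open>m + 1\<close> before the bend at \<open>e\<close> and
  \<open>m\<close> after it. Evenness of \<open>m\<close> excludes \<open>m = -1\<close> and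
  \<open>m = 1\<close>: the first slope never vanishes, and either \<open>m = 0\<close> or the
  slopes are steep enough to keep the mean near 1/2.\<close>

lemma has_integral_frac_bent:
  fixes m :: int and c e :: real
  assumes "even m" "0 < e" "e < 1"
  obtains J where "((\<lambda>t. frac (c + of_int m * t + min t e)) has_integral J) {0..1}"
    and "min (3 / 8) (e - e\<^sup>2 / 2) \<le> J"
proof -
  let ?f = "\<lambda>t. frac (c + of_int m * t + min t e)"
  have m1: "real_of_int m + 1 \<noteq> 0" using assms(1) by (metis even_plus_one_iff even_zero of_int_1 of_int_add of_int_eq_0_iff)
  define J1 where "J1 = e / 2 - (saw ((real_of_int m + 1) * e + c) - saw c) / (real_of_int m + 1)"
  have "((\<lambda>t. frac ((real_of_int m + 1) * t + c)) has_integral J1) {0..e}"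
    using has_integral_frac_linear[OF m1, of 0 e c] assms unfolding J1_def by simp
  then have 1: "(?f has_integral J1) {0..e}"
    by (rule has_integral_eq[rotated]) (simp add: algebra_simps)
  show thesis
  proof (cases "m = 0")
    case True
    have "((\<lambda>t. frac (c + e)) has_integral (1 - e) * frac (c + e)) {e..1}"
      using has_integral_const_real[of "frac (c + e)" e 1] assms by simp
    then have 2: "(?f has_integral (1 - e) * frac (c + e)) {e..1}"
      by (rule has_integral_eq[rotated]) (simp add: True)
    have "e - e\<^sup>2 / 2 \<le> J1 + (1 - e) * frac (c + e)"
    proof (cases "frac c + e < 1")
      case True
      then have "frac (c + e) = frac c + e"
        using assms frac_add[of c e] frac_eq[of e] by simp
      then show ?thesis using frac_ge_0[of c]
        unfolding J1_def saw_def by (simp add: \<open>m = 0\<close> add.commute) (simp add: power2_eq_square field_simps)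
    next
      \<comment> \<open>The argument reaches the next integer at \<open>t = 1 - frac c\<close> and
        stays beyond it up to \<open>t = 1\<close>. This wrap lowers the integral by exactly
        \<open>frac c\<close>, so the bound is attained.\<close>
      case False
      then have "frac (c + e) = frac c + e - 1"
        using assms frac_add[of c e] frac_eq[of e] by simp
      then show ?thesis
        unfolding J1_def saw_def by (simp add: \<open>m = 0\<close> add.commute) (simp add: power2_eq_square field_simps)
    qed
    then show thesis
      using that[OF has_integral_combine[OF _ _ 1 2]] assms by linarith
  next
    case False
    define J2 where "J2 = (1 - e) / 2 - (saw (c + e) - saw ((real_of_int m + 1) * e + c)) / m"
    have "saw (m * 1 + (c + e)) = saw (c + e)"
      using saw_add_int[of "c + e" m] by (simp add: add.commute)
    moreover have "real_of_int m * e + (c + e) = (real_of_int m + 1) * e + c" by (simp add: algebra_simps)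
    ultimately have "((\<lambda>t. frac (m * t + (c + e))) has_integral J2) {e..1}"
      using has_integral_frac_linear[of m e 1 "c + e"] False assms unfolding J2_def by (simp only:) simp
    then have 2: "(?f has_integral J2) {e..1}"
      by (rule has_integral_eq[rotated]) (simp add: algebra_simps)
    define P Q R where "P = saw c" and "Q = saw (c + e)" and "R = saw ((real_of_int m + 1) * e + c)"
    have bds: "0 \<le> P" "P \<le> 1/8" "0 \<le> Q" "Q \<le> 1/8" "0 \<le> R"
      unfolding P_def Q_def R_def by (rule saw_nonneg saw_le)+
    have m0: "real_of_int m \<noteq> 0" using False by simp
    have pos: "0 < real_of_int m * (real_of_int m + 1)"
    proof -
      have "m \<ge> 2 \<or> m \<le> -2" using False assms(1) by (auto elim!: evenE)
      then have "real_of_int m \<ge> 2 \<or> real_of_int m \<le> -2" by linarith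
      then show ?thesis by (auto intro: mult_neg_neg)
    qed
    \<comment> \<open>The two boundary terms at the bend combine to a nonnegative one, since
      \<open>m\<close> and \<open>m + 1\<close> have the same sign. Only the end terms
      \<open>P\<close> and \<open>Q\<close> can pull the integral below 1/2, and by at most
      1/8.\<close>
    have "R / m - R / (real_of_int m + 1) = R / (m * (real_of_int m + 1))"
      using m0 m1 by (simp add: field_simps)
    then have "J1 + J2 = 1 / 2 + P / (real_of_int m + 1) - Q / m + R / (m * (real_of_int m + 1))"
      unfolding J1_def J2_def P_def[symmetric] Q_def[symmetric] R_def[symmetric]
      by (simp add: diff_divide_distrib)
    moreover have "0 \<le> R / (m * (real_of_int m + 1))" using bds pos by simp
    moreover have "-1 / 8 \<le> P / (real_of_int m + 1) - Q / m"
    proof -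
      have "m \<ge> 2 \<or> m \<le> -2" using False assms(1) by (auto elim!: evenE)
      then show ?thesis
      proof
        assume "m \<ge> 2"
        then have m: "real_of_int m \<ge> 2" by linarith
        have "0 \<le> P / (real_of_int m + 1)" using m bds by simp
        moreover have "Q / m \<le> (1 / 8) / 1" using m bds by (intro frac_le) auto
        ultimately show ?thesis by simp
      next
        assume "m \<le> -2"
        then have m: "real_of_int m \<le> -2" by linarith
        have "0 \<le> Q / (- m)" using m bds by (intro divide_nonneg_pos) auto
        moreover have "P / (- (real_of_int m + 1)) \<le> (1 / 8) / 1" using m bds by (intro frac_le) auto
        ultimately show ?thesis by (simp only: of_int_minus of_int_add of_int_1 divide_minus_right)
      qed
    qed
    ultimately have "3 / 8 \<le> J1 + J2" by linarith
    then show thesis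
      using that[OF has_integral_combine[OF _ _ 1 2]] assms by linarith
  qed
qed

subsection \<open>Coverings in skew coordinates\<close>

text \<open>The sign \<open>g\<close> is the orientation: apex up for \<open>g = 1\<close>, apex down for \<open>g = -1\<close>. In the latter
case \<open>(a, b)\<close> is the corner at which \<open>x\<close> and \<open>y\<close> are maximal.\<close>

definition tri :: "int \<Rightarrow> real \<Rightarrow> real \<Rightarrow> real \<Rightarrow> (real \<times> real) set" where
  "tri g a b s = {(x, y). 0 \<le> g * (x - a) \<and> 0 \<le> g * (y - b) \<and> g * (x - a) + g * (y - b) \<le> s}"

definition unit_tris :: "(real \<times> real) set set" where
  "unit_tris = {tri g a b 1 | g a b. g = 1 \<or> g = -1}"

definition skew_coverable :: "nat \<Rightarrow> (real \<times> real) set \<Rightarrow> bool" where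
  "skew_coverable k A \<longleftrightarrow> (\<exists>C. finite C \<and> card C = k \<and> C \<subseteq> unit_tris \<and> A \<subseteq> \<Union>C)"

lemma unit_trisI: "g = 1 \<or> g = -1 \<Longrightarrow> tri g a b 1 \<in> unit_tris"
  unfolding unit_tris_def by blast

lemma image_tri:
  assumes "g = 1 \<or> g = -1"
  shows "(\<lambda>(x, y). (a + g * x, b + g * y)) ` tri h c d s = tri (g * h) (a + g * c) (b + g * d) s"
    (is "?f ` _ = _")
proof
  show "?f ` tri h c d s \<subseteq> tri (g * h) (a + g * c) (b + g * d) s"
    using assms by (auto simp: tri_def algebra_simps)
  show "tri (g * h) (a + g * c) (b + g * d) s \<subseteq> ?f ` tri h c d s"
  proof
    fix p assume p: "p \<in> tri (g * h) (a + g * c) (b + g * d) s"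
    obtain x y where xy: "p = (x, y)" by (cases p)
    have "p = ?f (g * (x - a), g * (y - b))" using assms xy by auto
    moreover have "(g * (x - a), g * (y - b)) \<in> tri h c d s"
      using p assms xy by (auto simp: tri_def algebra_simps)
    ultimately show "p \<in> ?f ` tri h c d s" by blast
  qed
qed

lemma skew_coverable_image:
  assumes "skew_coverable k A" "g = 1 \<or> g = (-1::int)"
  shows "skew_coverable k ((\<lambda>(x, y). (a + g * x, b + g * y)) ` A)" (is "skew_coverable k (?f ` A)")
proof -
  obtain C where C: "finite C" "card C = k" "C \<subseteq> unit_tris" "A \<subseteq> \<Union>C"
    using assms(1) unfolding skew_coverable_def by blast
  have "inj ?f" using assms(2) by (auto simp: inj_def)
  then have "inj_on ((`) ?f) C" by (meson inj_image_eq_iff inj_onI)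
  then have "card ((`) ?f ` C) = k" using C(2) card_image by blast
  moreover have "(`) ?f ` C \<subseteq> unit_tris"
  proof -
    have "?f ` S \<in> unit_tris" if SC: "S \<in> C" for S
    proof -
      obtain h c d where S: "S = tri h c d 1" and h: "h = 1 \<or> h = -1"
        using SC C(3) unfolding unit_tris_def by blast
      show ?thesis unfolding S image_tri[OF assms(2)] using h assms(2) by (intro unit_trisI) auto
    qed
    then show ?thesis by blast
  qed
  moreover have "?f ` A \<subseteq> \<Union>((`) ?f ` C)" using C(4) by blast
  ultimately show ?thesis using C(1) unfolding skew_coverable_def by blast
qed

lemma skew_coverable_tri_iff:
  assumes "g = 1 \<or> g = -1"
  shows "skew_coverable k (tri g a b s) \<longleftrightarrow> skew_coverable k (tri 1 0 0 s)"
proof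
  assume "skew_coverable k (tri g a b s)"
  \<comment> \<open>Since \<open>g * g = 1\<close>, this is the inverse of the translation or point
    reflection that carries the standard triangle to \<open>tri g a b s\<close>.\<close>
  from skew_coverable_image[OF this assms, of "- g * a" "- g * b"]
  show "skew_coverable k (tri 1 0 0 s)" unfolding image_tri[OF assms] using assms by auto
next
  assume "skew_coverable k (tri 1 0 0 s)"
  from skew_coverable_image[OF this assms, of a b]
  show "skew_coverable k (tri g a b s)" unfolding image_tri[OF assms] by simp
qed

lemma infinite_unit_tris: "infinite unit_tris"
proof
  assume "finite unit_tris"
  moreover have "range (\<lambda>a. tri 1 a 0 1) \<subseteq> unit_tris" by (auto intro: unit_trisI)
  moreover have "inj (\<lambda>a. tri 1 a 0 1)"
  proof (rule injI)
    fix a b :: real assume "tri 1 a 0 1 = tri 1 b 0 1"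
    moreover have "(a, 0) \<in> tri 1 a 0 1" "(b, 0) \<in> tri 1 b 0 1" by (auto simp: tri_def)
    ultimately have "(a, 0) \<in> tri 1 b 0 1" "(b, 0) \<in> tri 1 a 0 1" by auto
    then show "a = b" by (simp add: tri_def)
  qed
  ultimately show False using infinite_UNIV_char_0 finite_imageD finite_subset by metis
qed

text \<open>Coverings have exactly \<open>k\<close> distinct members, but unions of coverings may
  share triangles; the deficit is filled with fresh unit triangles, of which there are infinitely
  many.\<close>

lemma skew_coverableI:
  assumes "finite C" "card C \<le> k" "C \<subseteq> unit_tris" "A \<subseteq> \<Union>C"
  shows "skew_coverable k A"
proof -
  have "infinite (unit_tris - C)" using infinite_unit_tris assms(1) by simp
  then obtain B where B: "finite B" "card B = k - card C" "B \<subseteq> unit_tris - C"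
    using infinite_arbitrarily_large by metis
  then have "card (C \<union> B) = k" using assms by (subst card_Un_disjoint) auto
  then show ?thesis unfolding skew_coverable_def using assms B by (intro exI[of _ "C \<union> B"]) auto
qed

lemma skew_coverable_mono: "skew_coverable k A \<Longrightarrow> B \<subseteq> A \<Longrightarrow> skew_coverable k B"
  unfolding skew_coverable_def by blast

lemma skew_coverable_Un:
  assumes "skew_coverable k A" "skew_coverable l B" "D \<subseteq> A \<union> B"
  shows "skew_coverable (k + l) D"
proof -
  obtain C where C: "finite C" "card C = k" "C \<subseteq> unit_tris" "A \<subseteq> \<Union>C"
    using assms(1) unfolding skew_coverable_def by blast
  obtain C' where C': "finite C'" "card C' = l" "C' \<subseteq> unit_tris" "B \<subseteq> \<Union>C'"
    using assms(2) unfolding skew_coverable_def by blast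
  show ?thesis
    using C C' assms(3) card_Un_le[of C C'] by (intro skew_coverableI[of "C \<union> C'"]) auto
qed

lemma skew_coverable_unit: "g = 1 \<or> g = -1 \<Longrightarrow> skew_coverable 1 (tri g a b 1)"
  by (intro skew_coverableI[of "{tri g a b 1}"]) (auto intro: unit_trisI)

text \<open>Each step moves the slanted side right by \<open>1 - e\<close>. The hanging triangle
  with corner \<open>(?c, 1 + e)\<close> begins at \<open>x + y = ?c + e\<close>, exactly where the
  previous region ends; it takes the new points with \<open>x\<close> at most \<open>?c\<close>, and
  the standing triangle takes the rest.\<close>

lemma skew_coverable_strip:
  assumes "0 \<le> e"
  shows "skew_coverable (2 * k + 1) {(x, y). 0 \<le> x \<and> 0 \<le> y \<and> y \<le> 1 + e \<and> x + y \<le> real k * (1 - e) + 1}"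
    (is "skew_coverable _ (?A k)")
proof (induction k)
  case 0
  have "skew_coverable 1 (?A 0)"
    by (rule skew_coverable_mono[OF skew_coverable_unit[of 1 0 0]]) (auto simp: tri_def)
  then show ?case by simp
next
  case (Suc k)
  let ?c = "real (Suc k) * (1 - e)"
  have "?A (Suc k) \<subseteq> ?A k \<union> (tri 1 ?c 0 1 \<union> tri (-1) ?c (1 + e) 1)"
    by (auto simp: tri_def algebra_simps)
  moreover have "skew_coverable (1 + 1) (tri 1 ?c 0 1 \<union> tri (-1) ?c (1 + e) 1)"
    by (intro skew_coverable_Un[OF _ _ order_refl] skew_coverable_unit) simp_all
  ultimately have "skew_coverable (2 * k + 1 + (1 + 1)) (?A (Suc k))"
    using skew_coverable_Un[OF Suc.IH] by blast
  then show ?case by simp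
qed

text \<open>The equation for \<open>s\<close> aligns the slanted side of the strip with that of the
  large triangle, so only the triangle above height \<open>1 + e\<close> remains.\<close>

lemma skew_coverable_tri_step:
  assumes "0 \<le> e" "s = real k * (1 - e) + 1" "skew_coverable l (tri 1 0 0 (s - 1 - e))"
  shows "skew_coverable (l + (2 * k + 1)) (tri 1 0 0 s)"
proof (rule skew_coverable_Un)
  show "skew_coverable l (tri 1 0 (1 + e) (s - 1 - e))"
    using assms(3) skew_coverable_tri_iff[of 1] by blast
  show "tri 1 0 0 s \<subseteq> tri 1 0 (1 + e) (s - 1 - e) \<union>
    {(x, y). 0 \<le> x \<and> 0 \<le> y \<and> y \<le> 1 + e \<and> x + y \<le> real k * (1 - e) + 1}"
    unfolding assms(2) by (auto simp: tri_def)
qed (rule skew_coverable_strip[OF assms(1)])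

lemma skew_coverable_tri_nat: "m \<ge> 1 \<Longrightarrow> skew_coverable (m\<^sup>2) (tri 1 0 0 (real m))"
proof (induction m rule: nat_induct_at_least)
  case base
  show ?case using skew_coverable_unit[of 1 0 0] by simp
next
  case (Suc m)
  then have "skew_coverable (m\<^sup>2 + (2 * m + 1)) (tri 1 0 0 (real (Suc m)))"
    by (intro skew_coverable_tri_step[of 0]) auto
  moreover have "m\<^sup>2 + (2 * m + 1) = (Suc m)\<^sup>2" by (simp add: power2_eq_square)
  ultimately show ?case by metis
qed

lemma skew_coverable_optimal:
  assumes "n \<ge> 1"
  shows "skew_coverable (n\<^sup>2 + 2) (tri 1 0 0 (real n + 1 / (real n + 1)))"
proof -
  let ?e = "1 / (real n + 1)"
  \<comment> \<open>This equation, solved for \<open>?e\<close>, is where the value 1/(n+1) comes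
    from.\<close>
  have s: "real n + ?e = real n * (1 - ?e) + 1" by (simp add: field_simps)
  have s': "real n + ?e - 1 - ?e = real (n - 1)" using assms by (simp add: of_nat_diff)
  have card: "n\<^sup>2 + 2 = (n - 1)\<^sup>2 + (2 * n + 1)"
    using assms by (cases n) (simp_all add: power2_eq_square)
  have "skew_coverable ((n - 1)\<^sup>2 + (2 * n + 1)) (tri 1 0 0 (real n + ?e))"
  proof (cases "n = 1")
    \<comment> \<open>Here the part above the strip shrinks to a point, which zero triangles cannot
      cover; but the closed strip already contains that point.\<close>
    case True
    have "skew_coverable (2 * 1 + 1) (tri 1 0 0 (3 / 2))"
      by (rule skew_coverable_mono[OF skew_coverable_strip[of "1 / 2" 1]]) (auto simp: tri_def)
    then show ?thesis unfolding True by simp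
  next
    case False
    then have "skew_coverable ((n - 1)\<^sup>2) (tri 1 0 0 (real (n - 1)))"
      using assms by (intro skew_coverable_tri_nat) auto
    then show ?thesis
      by (intro skew_coverable_tri_step[OF _ s]) (simp_all only: s', simp)
  qed
  then show ?thesis unfolding card .
qed

subsection \<open>Optimality\<close>

lemma interval_cover_length:
  fixes lo hi :: "'a \<Rightarrow> real"
  assumes "finite I" "{0..L} \<subseteq> (\<Union>i\<in>I. {lo i..hi i})"
  shows "max 0 L \<le> (\<Sum>i\<in>I. max 0 (hi i - lo i))"
proof -
  have *: "emeasure lborel {a..b} = ennreal (max 0 (b - a))" for a b :: real
    by (cases "a \<le> b") (auto simp: max_def)
  have "emeasure lborel {0..L} \<le> emeasure lborel (\<Union>i\<in>I. {lo i..hi i})"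
    using assms by (intro emeasure_mono) auto
  also have "\<dots> \<le> (\<Sum>i\<in>I. emeasure lborel {lo i..hi i})"
    using assms(1) by (intro emeasure_subadditive_finite) auto
  also have "\<dots> = ennreal (\<Sum>i\<in>I. max 0 (hi i - lo i))"
    unfolding * by (intro sum_ennreal) simp
  finally show ?thesis unfolding * by (simp add: sum_nonneg)
qed

text \<open>Length of the section of a unit triangle at distance \<open>u\<close> from its horizontal side.\<close>

definition chord :: "real \<Rightarrow> real" where
  "chord u = (if 0 \<le> u then max 0 (1 - u) else 0)"

lemma tri_section:
  assumes "g = 1 \<or> g = -1"
  obtains lo hi where "\<And>x. (x, y) \<in> tri g a b 1 \<longleftrightarrow> x \<in> {lo..hi}" "max 0 (hi - lo) = chord (g * (y - b))"
proof (cases "0 \<le> g * (y - b)")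
  case True
  define w where "w = 1 - g * (y - b)"
  define lo where "lo = (if g = 1 then a else a - w)"
  show ?thesis
    using assms True by (intro that[of lo "lo + w"]) (auto simp: tri_def lo_def w_def chord_def)
next
  case False
  \<comment> \<open>The empty section is represented by the interval \<open>{1..0}\<close>.\<close>
  then show ?thesis using that[of 1 0] by (auto simp: tri_def chord_def)
qed

text \<open>The distances from the base at the heights \<open>t + k\<close> differ by integers, so
  at most one lies in [0,1), where \<open>chord\<close> can be nonzero. That distance is then the
  fractional part of \<open>g * (t - b)\<close>.\<close>

lemma sum_chord_le:
  assumes "g = 1 \<or> g = (-1::int)"
  shows "(\<Sum>k\<le>n. chord (g * (t + real k - b))) \<le> 1 - frac (g * (t - b))"
proof -
  define u where "u = g * (t - b)"
  have u: "g * (t + real k - b) = u + of_int (g * int k)" for k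
    unfolding u_def by (simp add: algebra_simps)
  have nz: "\<lfloor>u\<rfloor> = - (g * int k)" if "chord (u + of_int (g * int k)) \<noteq> 0" for k
  proof -
    have "0 \<le> u + of_int (g * int k)" "u + of_int (g * int k) < 1"
      using that unfolding chord_def by (auto split: if_splits)
    then have "\<lfloor>u + of_int (g * int k)\<rfloor> = 0" by (intro floor_unique) auto
    then show ?thesis by (simp only: floor_add_int[symmetric])
  qed
  show ?thesis
  proof (cases "\<exists>k\<le>n. chord (u + of_int (g * int k)) \<noteq> 0")
    case False
    then have "(\<Sum>k\<le>n. chord (u + of_int (g * int k))) = 0" by (intro sum.neutral) auto
    then show ?thesis using frac_lt_1[of u] unfolding u u_def[symmetric] by simp
  next
    case True
    then obtain j where j: "j \<le> n" "chord (u + of_int (g * int j)) \<noteq> 0" by blast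
    have "(\<Sum>k\<in>{..n} - {j}. chord (u + of_int (g * int k))) = 0"
    proof (intro sum.neutral ballI)
      fix k assume k: "k \<in> {..n} - {j}"
      show "chord (u + of_int (g * int k)) = 0"
      proof (rule ccontr)
        assume "chord (u + of_int (g * int k)) \<noteq> 0"
        from nz[OF this] nz[OF j(2)] show False using k assms by auto
      qed
    qed
    then have "(\<Sum>k\<le>n. chord (u + of_int (g * int k))) = chord (u + of_int (g * int j))"
      using j(1) by (subst sum.remove[of _ j]) auto
    moreover have "u + of_int (g * int j) = frac u"
      unfolding frac_def nz[OF j(2)] by simp
    ultimately show ?thesis using frac_lt_1[of u] unfolding u u_def[symmetric]
      by (simp add: chord_def)
  qed
qed

lemma has_integral_min:
  assumes "0 < e" "e < (1::real)"
  shows "((\<lambda>t. min t e) has_integral e - e\<^sup>2 / 2) {0..1}"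
proof -
  have "((\<lambda>t. t) has_integral (e\<^sup>2 - 0\<^sup>2) / 2) {0..e}"
    using ident_has_integral[of 0 e] assms by simp
  then have 1: "((\<lambda>t. min t e) has_integral (e\<^sup>2 - 0\<^sup>2) / 2) {0..e}"
    by (rule has_integral_eq[rotated]) simp
  have "((\<lambda>t. e) has_integral (1 - e) * e) {e..1}"
    using has_integral_const_real[of e e 1] assms by simp
  then have 2: "((\<lambda>t. min t e) has_integral (1 - e) * e) {e..1}"
    by (rule has_integral_eq[rotated]) simp
  have "(e\<^sup>2 - 0\<^sup>2) / 2 + (1 - e) * e = e - e\<^sup>2 / 2" by (simp add: power2_eq_square algebra_simps)
  moreover have "((\<lambda>t. min t e) has_integral (e\<^sup>2 - 0\<^sup>2) / 2 + (1 - e) * e) {0..1}"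
    using has_integral_combine[OF _ _ 1 2] assms by simp
  ultimately show ?thesis by metis
qed

lemma not_skew_coverable:
  assumes n: "n \<ge> 1" and e: "1 / (real n + 1) < e" "e < 1"
  shows "\<not> skew_coverable (n\<^sup>2 + 2) (tri 1 0 0 (real n + e))"
proof
  assume "skew_coverable (n\<^sup>2 + 2) (tri 1 0 0 (real n + e))"
  then obtain C where C: "finite C" "card C = n\<^sup>2 + 2" "C \<subseteq> unit_tris" "tri 1 0 0 (real n + e) \<subseteq> \<Union>C"
    unfolding skew_coverable_def by blast
  have "\<forall>S\<in>C. \<exists>g a b. (g = 1 \<or> g = -1) \<and> tri g a b 1 = S"
    using C(3) unfolding unit_tris_def by blast
  then obtain g a b where "\<forall>S\<in>C. (g S = 1 \<or> g S = -1) \<and> tri (g S) (a S) (b S) 1 = S"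
    unfolding bchoice_iff by blast
  then have g: "g S = 1 \<or> g S = -1" and S: "tri (g S) (a S) (b S) 1 = S" if "S \<in> C" for S
    using that by blast+
  have e0: "0 < e" using e(1) by (smt (verit) divide_nonneg_nonneg of_nat_0_le_iff)

  define F where "F t = (\<Sum>k\<le>n. max 0 (real n + e - t - real k))" for t :: real
  define G where "G t = (\<Sum>S\<in>C. 1 - frac (g S * (t - b S)))" for t :: real
  have FG: "F t \<le> G t" if "0 \<le> t" for t :: real
  proof -
    have "max 0 (real n + e - t - real k) \<le> (\<Sum>S\<in>C. chord (g S * (t + real k - b S)))" for k
    proof -
      have "\<forall>S\<in>C. \<exists>lo hi. (\<forall>x. (x, t + real k) \<in> S \<longleftrightarrow> x \<in> {lo..hi}) \<and>
          max 0 (hi - lo) = chord (g S * (t + real k - b S))"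
        using tri_section[OF g] S by metis
      then obtain lo hi where I: "\<forall>S\<in>C. (\<forall>x. (x, t + real k) \<in> S \<longleftrightarrow> x \<in> {lo S..hi S}) \<and>
          max 0 (hi S - lo S) = chord (g S * (t + real k - b S))"
        unfolding bchoice_iff by blast
      have "{0..real n + e - t - real k} \<subseteq> (\<Union>S\<in>C. {lo S..hi S})"
      proof
        fix x assume "x \<in> {0..real n + e - t - real k}"
        then have "(x, t + real k) \<in> tri 1 0 0 (real n + e)" using \<open>0 \<le> t\<close> by (simp add: tri_def)
        then show "x \<in> (\<Union>S\<in>C. {lo S..hi S})" using C(4) I by blast
      qed
      from interval_cover_length[OF C(1) this] show ?thesis using I by simp
    qed
    then have "F t \<le> (\<Sum>k\<le>n. \<Sum>S\<in>C. chord (g S * (t + real k - b S)))"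
      unfolding F_def by (intro sum_mono)
    also have "\<dots> = (\<Sum>S\<in>C. \<Sum>k\<le>n. chord (g S * (t + real k - b S)))" by (rule sum.swap)
    also have "\<dots> \<le> G t" unfolding G_def using g by (intro sum_mono sum_chord_le) auto
    finally show ?thesis .
  qed

  \<comment> \<open>\<open>K\<close> is kept as an integer so that it disappears modulo 1.\<close>
  define K where "K = int (\<Sum>{..<n})"
  have F: "F t = real n ^ 2 - K + n * e - n * t + e - min t e" if "0 \<le> t" "t \<le> 1" for t :: real
  proof -
    \<comment> \<open>For \<open>k < n\<close> the section has positive length throughout; only the
      topmost one can vanish, and it produces the bend \<open>min t e\<close>.\<close>
    have "F t = (\<Sum>k<n. max 0 (real n + e - t - real k)) + max 0 (e - t)"
      unfolding F_def lessThan_Suc_atMost[symmetric] by simp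
    also have "(\<Sum>k<n. max 0 (real n + e - t - real k)) = (\<Sum>k<n. real n + e - t - real k)"
      using that e0 by (intro sum.cong) (auto simp: max_def)
    also have "\<dots> = n * (n + e - t) - K" by (simp add: sum_subtractf K_def)
    also have "max 0 (e - t) = e - min t e" by (simp add: max_def min_def)
    finally show ?thesis by (simp add: power2_eq_square algebra_simps)
  qed
  have K: "2 * real_of_int K = real n ^ 2 - n"
  proof -
    have "2 * K = int n * (int n - 1)" unfolding K_def by (induction n) (auto simp: algebra_simps)
    then have "real_of_int (2 * K) = real_of_int (int n * (int n - 1))" by (simp only:)
    then show ?thesis by (simp add: power2_eq_square algebra_simps)
  qed

  define m where "m = int n - (\<Sum>S\<in>C. g S)"
  define c where "c = (\<Sum>S\<in>C. g S * b S) - n * e - e"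
  \<comment> \<open>All signs are odd, so their sum has the parity of \<open>card C\<close>, hence
    of \<open>n\<close>.\<close>
  have "{S \<in> C. odd (g S)} = C" using g by fastforce
  then have "even (\<Sum>S\<in>C. g S) \<longleftrightarrow> even n" using even_sum_iff[OF C(1), of g] C(2) by simp
  then have "even m" unfolding m_def by simp
  from has_integral_frac_bent[OF this e0 e(2), of c] obtain J where
    J: "((\<lambda>t. frac (c + m * t + min t e)) has_integral J) {0..1}" "min (3 / 8) (e - e\<^sup>2 / 2) \<le> J"
    by blast
  have frac_GF: "frac (c + m * t + min t e) = frac (G t - F t)" if "0 \<le> t" "t \<le> 1" for t :: real
  proof -
    have "G t = int (n\<^sup>2 + 2) - (\<Sum>S\<in>C. g S * (t - b S) - \<lfloor>g S * (t - b S)\<rfloor>)"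
      unfolding G_def frac_def by (simp add: sum_subtractf C(2))
    also have "\<dots> = int (n\<^sup>2 + 2) - t * (\<Sum>S\<in>C. g S) + (\<Sum>S\<in>C. g S * b S) + (\<Sum>S\<in>C. \<lfloor>g S * (t - b S)\<rfloor>)"
      by (simp add: sum_subtractf right_diff_distrib sum_distrib_left mult.commute)
    finally have "G t - F t = (c + m * t + min t e) + of_int (2 + K + (\<Sum>S\<in>C. \<lfloor>g S * (t - b S)\<rfloor>))"
      unfolding F[OF that] c_def m_def by (simp add: algebra_simps)
    then show ?thesis by (simp only: frac_add_of_int_right)
  qed

  \<comment> \<open>The interval is a full period, so the two \<open>saw\<close> terms cancel and
    the position of the triangle does not matter.\<close>
  have "((\<lambda>t. 1 - frac (g S * (t - b S))) has_integral 1 / 2) {0..1}" if "S \<in> C" for S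
  proof -
    have "((\<lambda>t. frac (g S * t + - (g S * b S))) has_integral 1 / 2) {0..1}"
      using has_integral_frac_linear[of "g S" 0 1 "- (g S * b S)"] g[OF that]
        saw_add_int[of "- (g S * b S)" "g S"] by (auto simp: add.commute)
    from has_integral_diff[OF has_integral_const_real[of 1 0 1] this]
    show ?thesis by (simp add: right_diff_distrib)
  qed
  then have "(G has_integral (\<Sum>S\<in>C. 1 / 2)) {0..1}"
    unfolding G_def by (intro has_integral_sum C(1)) auto
  then have G_int: "(G has_integral (real n ^ 2 + 2) / 2) {0..1}" using C(2) by (simp add: add.commute)
  have "((\<lambda>t. (real n ^ 2 - K + n * e + e) - n * t - min t e) has_integral
      (real n ^ 2 - K + n * e + e) - n * (1 / 2) - (e - e\<^sup>2 / 2)) {0..1}"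
    using has_integral_const_real[of "real n ^ 2 - K + n * e + e" 0 1] ident_has_integral[of 0 "1::real"]
    by (intro has_integral_diff has_integral_mult_right has_integral_min e0 e(2)) auto
  then have F_int: "(F has_integral real n ^ 2 - K + n * e - n / 2 + e\<^sup>2 / 2) {0..1}"
    by (rule has_integral_eq[rotated, THEN has_integral_eq_rhs]) (auto simp: F)
  have "J \<le> (real n ^ 2 + 2) / 2 - (real n ^ 2 - K + n * e - n / 2 + e\<^sup>2 / 2)"
  proof (rule has_integral_le[OF J(1) has_integral_diff[OF G_int F_int]])
    fix t :: real assume t: "t \<in> {0..1}"
    then have "0 \<le> G t - F t" using FG by simp
    then have "0 \<le> \<lfloor>G t - F t\<rfloor>" by simp
    then have "frac (G t - F t) \<le> G t - F t" unfolding frac_def by simp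
    then show "frac (c + m * t + min t e) \<le> G t - F t" using frac_GF t by simp
  qed
  then have "J \<le> 1 - n * e - e\<^sup>2 / 2" using K by (simp add: field_simps)
  moreover have ne: "1 < n * e + e" using e(1) n by (simp add: field_simps)
  ultimately have "J < e - e\<^sup>2 / 2" by linarith
  \<comment> \<open>At \<open>e = 1/2\<close> both \<open>e - e^2/2\<close> and
    \<open>1 - e - e^2/2\<close> equal 3/8. The first increases on [0,1] and bounds \<open>J\<close>
    for smaller \<open>e\<close>; the second decreases and bounds \<open>J\<close> for larger
    \<open>e\<close>.\<close>
  moreover have "J < 3 / 8"
  proof (cases "e \<le> 1 / 2")
    case True
    have "0 \<le> (1 / 2 - e) * (3 / 2 - e)" using True by (intro mult_nonneg_nonneg) auto
    moreover have "(1 / 2 - e) * (3 / 2 - e) = 3 / 4 - 2 * e + e\<^sup>2"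
      by (simp add: power2_eq_square field_simps)
    ultimately have "e - e\<^sup>2 / 2 \<le> 3 / 8" by linarith
    then show ?thesis using \<open>J < e - e\<^sup>2 / 2\<close> by linarith
  next
    case False
    have "1 * e \<le> n * e" using n e0 by (intro mult_right_mono) auto
    moreover have "(1 / 2)\<^sup>2 < e\<^sup>2" using False by (intro power_strict_mono) auto
    then have "1 / 4 < e\<^sup>2" by (simp add: power_divide)
    ultimately show ?thesis using False \<open>J \<le> 1 - n * e - e\<^sup>2 / 2\<close> by linarith
  qed
  ultimately show False using J(2) by linarith
qed

subsection \<open>Equilateral triangles in skew coordinates\<close>

text \<open>The linear map taking the standard basis to two unit vectors at 60 degrees.\<close>

definition pt :: "real \<times> real \<Rightarrow> real^2" where
  "pt = (\<lambda>(x, y). vector [x + y / 2, sqrt 3 / 2 * y])"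

lemma pt_nth [simp]: "pt (x, y) $ 1 = x + y / 2" "pt (x, y) $ 2 = sqrt 3 / 2 * y"
  by (simp_all add: pt_def)

lemma linear_pt: "linear pt"
  by (rule linearI) (auto simp: vec_eq_iff forall_2 algebra_simps)

lemma inj_pt: "inj pt"
proof (rule injI)
  fix p q assume "pt p = pt q"
  then have "pt p $ 1 = pt q $ 1" "pt p $ 2 = pt q $ 2" by simp_all
  then show "p = q" by (cases p; cases q) auto
qed

lemma tri_eq_hull:
  assumes "g = 1 \<or> g = -1" "s > 0"
  shows "tri g a b s = convex hull {(a, b), (a + g * s, b), (a, b + g * s)}"
proof (intro set_eqI iffI)
  fix p assume p: "p \<in> tri g a b s"
  obtain x y where xy: "p = (x, y)" by (cases p)
  define u v where "u = g * (x - a) / s" and "v = g * (y - b) / s"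
  have "u + v = (g * (x - a) + g * (y - b)) / s" unfolding u_def v_def by (simp add: add_divide_distrib)
  then have "0 \<le> u" "0 \<le> v" "u + v \<le> 1"
    using p assms(2) unfolding u_def v_def xy tri_def by simp_all
  moreover have "p = (a, b) + u *\<^sub>R ((a + g * s, b) - (a, b)) + v *\<^sub>R ((a, b + g * s) - (a, b))"
    using assms unfolding u_def v_def xy by auto
  ultimately show "p \<in> convex hull {(a, b), (a + g * s, b), (a, b + g * s)}"
    unfolding convex_hull_3_alt by blast
next
  fix p assume "p \<in> convex hull {(a, b), (a + g * s, b), (a, b + g * s)}"
  then obtain u v where uv: "0 \<le> u" "0 \<le> v" "u + v \<le> 1"
    and p: "p = (a, b) + u *\<^sub>R ((a + g * s, b) - (a, b)) + v *\<^sub>R ((a, b + g * s) - (a, b))"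
    unfolding convex_hull_3_alt by blast
  have "u * s + v * s \<le> s" using uv assms(2) by (simp flip: distrib_right)
  then show "p \<in> tri g a b s"
    unfolding p tri_def using uv assms by auto
qed

lemma pt_tri_eq_hull:
  assumes "g = 1 \<or> g = -1" "s > 0"
  shows "pt ` tri g a b s = convex hull {pt (a, b), pt (a + g * s, b), pt (a, b + g * s)}"
  unfolding tri_eq_hull[OF assms] using convex_hull_linear_image[OF linear_pt] by simp

lemma dist_vec2: "dist (p :: real^2) q = sqrt ((p $ 1 - q $ 1)\<^sup>2 + (p $ 2 - q $ 2)\<^sup>2)"
  by (simp add: dist_norm norm_vec_def L2_set_def sum_2)

text \<open>The Euclidean metric pulls back to the form u^2 + uv + v^2, which takes the value s^2 at
  (s,0), (0,s) and (s,-s), the edges of a skew triangle.\<close>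

lemma dist_pt:
  "dist (pt (x, y)) (pt (x', y')) = sqrt ((x - x')\<^sup>2 + (x - x') * (y - y') + (y - y')\<^sup>2)"
proof -
  have "(sqrt 3 / 2 * y - sqrt 3 / 2 * y')\<^sup>2 = 3 / 4 * (y - y')\<^sup>2"
    unfolding right_diff_distrib[symmetric] power_mult_distrib power_divide by simp
  moreover have "(x + y / 2 - (x' + y' / 2))\<^sup>2 = (x - x')\<^sup>2 + (x - x') * (y - y') + (y - y')\<^sup>2 / 4"
    by (simp add: power2_eq_square field_simps)
  ultimately show ?thesis unfolding dist_vec2 by simp
qed

lemma equilateral_H_triangle_pt_tri:
  assumes "g = 1 \<or> g = -1" "s > 0"
  shows "equilateral_H_triangle s (pt ` tri g a b s)"
proof -
  let ?p = "pt (a, b)" and ?q = "pt (a + g * s, b)" and ?r = "pt (a, b + g * s)"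
  have "\<not> collinear {?q, ?p, ?r}"
  proof
    assume "collinear {?q, ?p, ?r}"
    then have "collinear {0, ?q - ?p, ?r - ?p}" by (simp add: collinear_3)
    then have "?q - ?p = 0 \<or> ?r - ?p = 0 \<or> (\<exists>c. ?r - ?p = c *\<^sub>R (?q - ?p))"
      unfolding collinear_lemma .
    then have "(?q - ?p) $ 1 = 0 \<or> (?r - ?p) $ 2 = 0"
    proof (elim disjE exE)
      fix c assume "?r - ?p = c *\<^sub>R (?q - ?p)"
      then have "(?r - ?p) $ 2 = (c *\<^sub>R (?q - ?p)) $ 2" by (rule arg_cong)
      then show ?thesis by simp
    qed (simp_all only: zero_index simp_thms)
    then show False using assms by auto
  qed
  then have "H_triangle ?p ?q ?r" unfolding H_triangle_def by (simp add: insert_commute)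
  moreover have "dist ?p ?q = s" "dist ?q ?r = s" "dist ?r ?p = s"
    unfolding dist_pt using assms by (auto simp: power2_eq_square)
  ultimately show ?thesis
    unfolding equilateral_H_triangle_def pt_tri_eq_hull[OF assms] by blast
qed

lemma equilateral_base_hull:
  fixes p q r :: "real^2"
  assumes "s > 0" "p $ 2 = q $ 2" "dist p q = s" "dist q r = s" "dist r p = s"
  shows "\<exists>g a b. (g = 1 \<or> g = -1) \<and> convex hull {p, q, r} = pt ` tri g a b s"
proof -
  define d x y where "d = q $ 1 - p $ 1" and "x = r $ 1 - p $ 1" and "y = r $ 2 - p $ 2"
  have "d\<^sup>2 = s\<^sup>2"
    using assms(1-3) unfolding dist_vec2 d_def by (auto simp: power2_commute)
  have "x\<^sup>2 + y\<^sup>2 = s\<^sup>2"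
    using assms(5) unfolding dist_vec2 x_def y_def by auto
  have "(d - x)\<^sup>2 + y\<^sup>2 = s\<^sup>2"
    using assms(2,4) unfolding dist_vec2 x_def y_def d_def by (auto simp: power2_commute)
  have d: "d = s \<or> d = - s" using \<open>d\<^sup>2 = s\<^sup>2\<close> by (simp add: power2_eq_iff)
  \<comment> \<open>Equal distances to both ends of the base put the apex above or below its
    midpoint; the sign of its height \<open>y\<close> is the orientation \<open>g\<close>.\<close>
  have "(d - x)\<^sup>2 = x\<^sup>2"
    using \<open>x\<^sup>2 + y\<^sup>2 = s\<^sup>2\<close> \<open>(d - x)\<^sup>2 + y\<^sup>2 = s\<^sup>2\<close> by linarith
  moreover have "d * (2 * x - d) = x\<^sup>2 - (d - x)\<^sup>2"
    by (simp add: power2_eq_square algebra_simps)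
  ultimately have "d * (2 * x - d) = 0" by simp
  moreover have "d \<noteq> 0" using d assms(1) by auto
  ultimately have "2 * x - d = 0" by (metis mult_eq_0_iff)
  then have x: "x = d / 2" by simp
  have "y\<^sup>2 = (sqrt 3 / 2 * s)\<^sup>2"
    using \<open>x\<^sup>2 + y\<^sup>2 = s\<^sup>2\<close> \<open>d\<^sup>2 = s\<^sup>2\<close> unfolding x power_mult_distrib power_divide by simp
  then obtain g :: int where g: "g = 1 \<or> g = -1" and y: "y = g * (sqrt 3 / 2 * s)"
    unfolding power2_eq_iff by (metis mult_1 mult_minus1 of_int_1 of_int_minus)
  have base: "\<exists>g a b. (g = 1 \<or> g = -1) \<and> convex hull {p', q', r} = pt ` tri g a b s"
    if "q' $ 2 = p' $ 2" "q' $ 1 = p' $ 1 + g * s"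
      "r $ 1 = p' $ 1 + g * s / 2" "r $ 2 = p' $ 2 + g * (sqrt 3 / 2 * s)" for p' q'
  proof -
    \<comment> \<open>These are the skew coordinates of \<open>p'\<close>, that is, its preimage
      under \<open>pt\<close>.\<close>
    define a b where "a = p' $ 1 - p' $ 2 / sqrt 3" and "b = 2 * p' $ 2 / sqrt 3"
    have ab: "a + b / 2 = p' $ 1" "sqrt 3 / 2 * b = p' $ 2" by (simp_all add: a_def b_def)
    have pts: "p' = pt (a, b)" "q' = pt (a + g * s, b)" "r = pt (a, b + g * s)"
      unfolding vec_eq_iff forall_2 using that ab by (simp_all add: ring_distribs add_divide_distrib mult_ac)
    show ?thesis
      using pt_tri_eq_hull[OF g assms(1), of a b] g unfolding pts[symmetric] by blast
  qed
  show ?thesis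
  \<comment> \<open>The corner \<open>(a, b)\<close> is the left end of the base for apex up and the
    right end for apex down. If \<open>p\<close> is the other end, \<open>p\<close> and
    \<open>q\<close> are exchanged.\<close>
  proof (cases "d = g * s")
    case True
    then show ?thesis using base[where p' = p and q' = q] assms(2) x y by (simp add: d_def x_def y_def)
  next
    case False
    then have "d = - (g * s)" using d g by auto
    then have "\<exists>g a b. (g = 1 \<or> g = -1) \<and> convex hull {q, p, r} = pt ` tri g a b s"
      using base[where p' = q and q' = p] assms(2) x y by (simp add: d_def x_def y_def)
    then show ?thesis by (simp add: insert_commute)
  qed
qed

lemma equilateral_H_triangle_iff:
  assumes "s > 0"
  shows "equilateral_H_triangle s T \<longleftrightarrow> (\<exists>g a b. (g = 1 \<or> g = -1) \<and> T = pt ` tri g a b s)"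
proof
  assume "equilateral_H_triangle s T"
  then obtain p q r where d: "dist p q = s" "dist q r = s" "dist r p = s"
    and T: "T = convex hull {p, q, r}"
    and "p $ 2 = q $ 2 \<or> q $ 2 = r $ 2 \<or> r $ 2 = p $ 2"
    unfolding equilateral_H_triangle_def H_triangle_def by blast
  then consider "p $ 2 = q $ 2" | "q $ 2 = r $ 2" | "r $ 2 = p $ 2" by blast
  then show "\<exists>g a b. (g = 1 \<or> g = -1) \<and> T = pt ` tri g a b s"
  proof cases
    case 1
    then show ?thesis unfolding T by (rule equilateral_base_hull[OF assms _ d])
  next
    case 2
    have "T = convex hull {q, r, p}" unfolding T by (simp add: insert_commute)
    then show ?thesis using equilateral_base_hull[OF assms 2 d(2,3,1)] by simp
  next
    case 3
    have "T = convex hull {r, p, q}" unfolding T by (simp add: insert_commute)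
    then show ?thesis using equilateral_base_hull[OF assms 3 d(3,1,2)] by simp
  qed
qed (use equilateral_H_triangle_pt_tri[OF _ assms] in blast)

text \<open>As \<open>pt\<close> is injective, it maps families of triangles bijectively, preserving
  their cardinality and the covering relation.\<close>

lemma coverable_pt_image_iff:
  "coverable_by_unit_H_triangles k (pt ` A) \<longleftrightarrow> skew_coverable k A"
proof
  assume "coverable_by_unit_H_triangles k (pt ` A)"
  then obtain C where C: "finite C" "card C = k" "\<forall>S\<in>C. equilateral_H_triangle 1 S" "pt ` A \<subseteq> \<Union>C"
    unfolding coverable_by_unit_H_triangles_def by blast
  have "C \<subseteq> (`) pt ` unit_tris"
  proof
    fix S assume "S \<in> C"
    then obtain g a b where "g = 1 \<or> g = -1" "S = pt ` tri g a b 1"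
      using C(3) equilateral_H_triangle_iff[OF zero_less_one] by metis
    then show "S \<in> (`) pt ` unit_tris" by (simp add: unit_trisI)
  qed
  then obtain D where D: "D \<subseteq> unit_tris" "C = (`) pt ` D" by (auto simp: subset_image_iff)
  have inj: "inj_on ((`) pt) D" using inj_pt by (meson inj_image_eq_iff inj_onI)
  have "finite D" "card D = k"
    using C(1,2) inj unfolding D(2) by (simp_all add: finite_image_iff card_image)
  moreover have "A \<subseteq> \<Union>D"
    using C(4) unfolding D(2) image_Union[symmetric] inj_image_subset_iff[OF inj_pt] .
  ultimately show "skew_coverable k A" unfolding skew_coverable_def using D(1) by blast
next
  assume "skew_coverable k A"
  then obtain D where D: "finite D" "card D = k" "D \<subseteq> unit_tris" "A \<subseteq> \<Union>D"
    unfolding skew_coverable_def by blast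
  have inj: "inj_on ((`) pt) D" using inj_pt by (meson inj_image_eq_iff inj_onI)
  have "\<forall>S\<in>(`) pt ` D. equilateral_H_triangle 1 S"
  proof
    fix T assume "T \<in> (`) pt ` D"
    then obtain S where "S \<in> unit_tris" and T: "T = pt ` S" using D(3) by blast
    then obtain g a b where "g = 1 \<or> g = -1" "S = tri g a b 1" unfolding unit_tris_def by blast
    then show "equilateral_H_triangle 1 T" unfolding T by (simp add: equilateral_H_triangle_pt_tri)
  qed
  moreover have "pt ` A \<subseteq> \<Union>((`) pt ` D)" using D(4) by (simp only: image_Union[symmetric] image_mono)
  ultimately show "coverable_by_unit_H_triangles k (pt ` A)"
    unfolding coverable_by_unit_H_triangles_def using D(1,2) card_image[OF inj]
    by (intro exI[of _ "(`) pt ` D"]) simp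
qed

lemma coverable_equilateral_H_triangle_iff:
  assumes "s > 0" "equilateral_H_triangle s T"
  shows "coverable_by_unit_H_triangles k T \<longleftrightarrow> skew_coverable k (tri 1 0 0 s)"
proof -
  obtain g a b where "g = 1 \<or> g = -1" and T: "T = pt ` tri g a b s"
    using assms(2) equilateral_H_triangle_iff[OF assms(1)] by metis
  then show ?thesis unfolding T coverable_pt_image_iff by (intro skew_coverable_tri_iff)
qed

theorem theorem4:
  fixes n :: nat
  assumes "n \<ge> 1"
  shows "(\<forall>T. equilateral_H_triangle (real n + 1 / (real n + 1)) T \<longrightarrow>
              coverable_by_unit_H_triangles (n^2 + 2) T) \<and>
         (\<forall>\<epsilon>::real. \<epsilon> > 1 / (real n + 1) \<longrightarrow>
            (\<forall>T. equilateral_H_triangle (real n + \<epsilon>) T \<longrightarrow>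
                 \<not> coverable_by_unit_H_triangles (n^2 + 2) T))"
proof (intro conjI allI impI)
  fix T assume T: "equilateral_H_triangle (real n + 1 / (real n + 1)) T"
  have "0 < real n + 1 / (real n + 1)" by (intro add_nonneg_pos) simp_all
  from coverable_equilateral_H_triangle_iff[OF this T]
  show "coverable_by_unit_H_triangles (n^2 + 2) T"
    using skew_coverable_optimal[OF assms] by blast
next
  fix \<epsilon> :: real and T
  assume \<epsilon>: "\<epsilon> > 1 / (real n + 1)" and T: "equilateral_H_triangle (real n + \<epsilon>) T"
  \<comment> \<open>The integral argument needs \<open>e < 1\<close>. Any cap strictly between 1/2
    and 1 keeps \<open>e\<close> above 1/(n+1), and a covering of the larger triangle also covers
    the smaller one.\<close>
  define e where "e = min \<epsilon> (3 / 4)"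
  have "1 / (real n + 1) \<le> 1 / 2" using assms by (intro divide_left_mono) auto
  then have e: "1 / (real n + 1) < e" "e < 1" "e \<le> \<epsilon>"
    using \<epsilon> unfolding e_def by linarith+
  have "0 < 1 / (real n + 1)" by simp
  then have pos: "0 < real n + \<epsilon>" using \<epsilon> by linarith
  have "tri 1 0 0 (real n + e) \<subseteq> tri 1 0 0 (real n + \<epsilon>)" using e(3) by (auto simp: tri_def)
  then have "\<not> skew_coverable (n\<^sup>2 + 2) (tri 1 0 0 (real n + \<epsilon>))"
    using not_skew_coverable[OF assms e(1,2)] skew_coverable_mono by blast
  then show "\<not> coverable_by_unit_H_triangles (n^2 + 2) T"
    unfolding coverable_equilateral_H_triangle_iff[OF pos T] .
qed

end
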